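(* Let $l\in\mathbb N$ and let $M=(M^1,\dots,M^l)$ and $N=(N^1,\dots,N^l)$ be $\mathbb R^l$-valued continuous martingales on $[0,1]$, where the coordinate processes $N^1,\dots,N^l$ are independent. Then $$h_l(\mathcal L(M)|\mathcal L(N))\ \ge\ \sum_{i=1}^lh_1(\mathcal L(M^i)|\mathcal L(N^i)).$$
   Context: $\mathcal L(\cdot)$ denotes the law on path space. For $d\in\mathbb N$, on $C([0,1];\mathbb R^d)$ with canonical process $X_t(\omega)=\omega(t)$, put $\mathcal F^n:=\sigma(X_{k/n}:k=0,1,\dots,n)$. Relative entropy: $H(\mu|\nu)=\int\log\frac{d\mu}{d\nu}\,d\mu$ if $\mu\ll\nu$, and $+\infty$ otherwise; $H(\mathbb Q|\mathbb P)|_{\mathcal F^n}$ is the relative entropy between the restrictions of $\mathbb Q$ and $\mathbb P$ to $\mathcal F^n$. For probability measures $\mathbb Q,\mathbb P$ on $C([0,1];\mathbb R^d)$ under which $X$ is a martingale, the specific relative entropy is $h_d(\mathbb Q|\mathbb P):=\liminf_{n\to\infty}2^{-n}H(\mathbb Q|\mathbb P)|_{\mathcal F^{2^n}}$. *)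

theory Defs
  imports "HOL-Probability.Probability"
begin

(* C([0,1]; 'a).  A path is stored as a function that is "undefined" outside [0,1] (extensional
   function space).  The sigma-algebra is the one generated by the evaluations at t in [0,1],
   which on C([0,1]; 'a) is the Borel sigma-algebra of the supremum norm.  Only the space and the
   sigma-algebra matter; the measure carried by this value is never used. *)
definition path_space :: "(real \<Rightarrow> 'a::euclidean_space) measure" where
  "path_space = restrict_space (PiM {0..1} (\<lambda>_. borel)) {\<omega>. continuous_on {0..1} \<omega>}"

definition path_of :: "(real \<Rightarrow> 'w \<Rightarrow> 'a::euclidean_space) \<Rightarrow> 'w \<Rightarrow> real \<Rightarrow> 'a" where
  "path_of X w = (\<lambda>t\<in>{0..1}. X t w)"

definition path_law :: "'w measure \<Rightarrow> (real \<Rightarrow> 'w \<Rightarrow> 'a::euclidean_space) \<Rightarrow> (real \<Rightarrow> 'a) measure" where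
  "path_law P X = distr P path_space (path_of X)"

(* The martingale property is stated coordinatewise because the library's conditional
   expectation is real-valued.  Every path is required to be continuous, so that path_of X is a
   path-space-valued random variable. *)
definition continuous_martingale ::
    "'w measure \<Rightarrow> (real \<Rightarrow> 'w measure) \<Rightarrow> (real \<Rightarrow> 'w \<Rightarrow> 'a::euclidean_space) \<Rightarrow> bool" where
  "continuous_martingale P F X \<longleftrightarrow>
     prob_space P \<and>
     (\<forall>t\<in>{0..1}. subalgebra P (F t)) \<and>
     (\<forall>s\<in>{0..1}. \<forall>t\<in>{0..1}. s \<le> t \<longrightarrow> subalgebra (F t) (F s)) \<and>
     (\<forall>t\<in>{0..1}. X t \<in> borel_measurable (F t)) \<and>
     (\<forall>t\<in>{0..1}. integrable P (X t)) \<and>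
     (\<forall>s\<in>{0..1}. \<forall>t\<in>{0..1}. s \<le> t \<longrightarrow>
        (\<forall>b\<in>Basis. AE w in P. real_cond_exp P (F s) (\<lambda>w. X t w \<bullet> b) w = X s w \<bullet> b)) \<and>
     (\<forall>w\<in>space P. continuous_on {0..1} (\<lambda>t. X t w))"

definition grid_algebra :: "nat \<Rightarrow> (real \<Rightarrow> 'a::euclidean_space) measure" where
  "grid_algebra n = sigma (space path_space)
     {(\<lambda>\<omega>. \<omega> (real k / real n)) -` A \<inter> space path_space | k A. k \<le> n \<and> A \<in> sets borel}"

(* The integral of log(d mu / d nu) as an extended real: integral of the positive part minus
   integral of the negative part (ennreal truncates negative reals to 0).  For probability
   measures the second term is always finite. *)
definition relative_entropy :: "'b measure \<Rightarrow> 'b measure \<Rightarrow> ereal" where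
  "relative_entropy \<mu> \<nu> =
     (if absolutely_continuous \<nu> \<mu>
      then enn2ereal (\<integral>\<^sup>+x. ennreal (entropy_density (exp 1) \<nu> \<mu> x) \<partial>\<mu>)
         - enn2ereal (\<integral>\<^sup>+x. ennreal (- entropy_density (exp 1) \<nu> \<mu> x) \<partial>\<mu>)
      else \<infinity>)"

definition specific_relative_entropy ::
    "(real \<Rightarrow> 'a::euclidean_space) measure \<Rightarrow> (real \<Rightarrow> 'a) measure \<Rightarrow> ereal" where
  "specific_relative_entropy Q P =
     liminf (\<lambda>n. ereal (1 / 2 ^ n) *
       relative_entropy (restr_to_subalg Q (grid_algebra (2 ^ n)))
                        (restr_to_subalg P (grid_algebra (2 ^ n))))"

lemma subalgebra_grid_algebra:
  assumes "n > 0"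
  shows "subalgebra path_space (grid_algebra n :: (real \<Rightarrow> 'a::euclidean_space) measure)"
proof -
  let ?G = "{(\<lambda>\<omega>. \<omega> (real k / real n)) -` A \<inter> space path_space | k A. k \<le> n \<and> A \<in> sets borel}
    :: (real \<Rightarrow> 'a) set set"
  have ev: "(\<lambda>\<omega>. \<omega> (real k / real n)) \<in> borel_measurable (path_space :: (real \<Rightarrow> 'a) measure)"
    if "k \<le> n" for k
    unfolding path_space_def using assms that
    by (intro measurable_restrict_space1 measurable_component_singleton) (auto simp: field_simps)
  have sub: "?G \<subseteq> sets path_space"
    using measurable_sets[OF ev] by blast
  have pow: "?G \<subseteq> Pow (space path_space)"
    by blast
  show ?thesis
    unfolding subalgebra_def grid_algebra_def
    using sets.sigma_sets_subset[OF sub] pow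
    by (simp add: sets_measure_of space_measure_of)
qed

lemma measurable_path_of:
  assumes "continuous_martingale P F X"
  shows "path_of X \<in> measurable P path_space"
  unfolding path_space_def
proof (rule measurable_restrict_space2)
  have "continuous_on {0..1} (path_of X w)" if "w \<in> space P" for w
  proof -
    have "continuous_on {0..1} (\<lambda>t. X t w)"
      using assms that unfolding continuous_martingale_def by blast
    then show ?thesis
      by (rule continuous_on_eq) (simp add: path_of_def)
  qed
  then show "path_of X \<in> space P \<rightarrow> {\<omega>. continuous_on {0..1} \<omega>}"
    by simp
  have "X t \<in> borel_measurable P" if "t \<in> {0..1}" for t
  proof (rule measurable_from_subalg)
    show "subalgebra P (F t)" "X t \<in> borel_measurable (F t)"
      using assms that unfolding continuous_martingale_def by blast+
  qed
  then show "path_of X \<in> measurable P (PiM {0..1} (\<lambda>_. borel))"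
    unfolding path_of_def[abs_def] by (rule measurable_restrict)
qed

lemma relative_entropy_eq_KL_divergence:
  assumes "absolutely_continuous \<nu> \<mu>" "integrable \<mu> (entropy_density (exp 1) \<nu> \<mu>)"
  shows "relative_entropy \<mu> \<nu> = ereal (KL_divergence (exp 1) \<nu> \<mu>)"
proof -
  let ?f = "entropy_density (exp 1) \<nu> \<mu>"
  have "(\<integral>\<^sup>+x. ennreal (?f x) \<partial>\<mu>) \<noteq> \<infinity>" "(\<integral>\<^sup>+x. ennreal (- ?f x) \<partial>\<mu>) \<noteq> \<infinity>"
    using assms(2) by (auto simp: real_integrable_def)
  then obtain a b where "0 \<le> a" "(\<integral>\<^sup>+x. ennreal (?f x) \<partial>\<mu>) = ennreal a"
    "0 \<le> b" "(\<integral>\<^sup>+x. ennreal (- ?f x) \<partial>\<mu>) = ennreal b"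
    by (metis ennreal_cases infinity_ennreal_def)
  then show ?thesis
    using assms unfolding relative_entropy_def KL_divergence_def
    by (simp add: real_lebesgue_integral_def enn2ereal_ennreal)
qed

end

theory Submission
  imports Defs
begin

text \<open>
  On every dyadic grid the claim is the superadditivity of relative entropy with respect to a
  second measure that is a product: if the coordinates are independent under \<open>\<nu>\<close>, then
  \<open>H(\<mu>|\<nu>)\<close> is at least the sum of the entropies of the coordinate marginals. The inequality
  survives the factor \<open>2\<^sup>-\<^sup>n\<close> and the limit inferior, because the limit inferior is itself
  superadditive on nonnegative sequences.

  Superadditivity follows from the Donsker--Varadhan formula
  \[ H(\mu|\nu) = \sup_f \Bigl( \int f\,d\mu - \log \int e^f\,d\nu \Bigr), \]
  where \<open>f\<close> ranges over the bounded measurable functions. For a test function of the form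
  \<open>f = \<Sum>i. f\<^sub>i \<circ> g\<^sub>i\<close> with coordinate maps \<open>g\<^sub>i\<close> that are independent under \<open>\<nu>\<close>, the integral of
  \<open>e\<^sup>f\<close> factorises. The functional at \<open>f\<close> is therefore the sum of the functionals of the
  marginals at the \<open>f\<^sub>i\<close>, and each \<open>f\<^sub>i\<close> can be chosen to approach the supremum for its marginal.
  Infinite entropies, with or without absolute continuity, are covered by the same argument, since
  the formula holds for them too.

  The two halves of the formula are \<open>gibbs_functional_le_relative_entropy\<close> and
  \<open>gibbs_functional_tendsto_relative_entropy\<close>; the second gives a sequence of test functions
  rather than a supremum, so that finitely many marginals can be handled by adding limits.
  Superadditivity is \<open>relative_entropy_superadditive\<close>.
\<close>

section \<open>Bounded test functions and the Gibbs functional\<close>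

definition bounded_measurable :: "'a measure \<Rightarrow> ('a \<Rightarrow> real) \<Rightarrow> bool" where
  "bounded_measurable S f \<longleftrightarrow> f \<in> borel_measurable S \<and> (\<exists>B. \<forall>x. \<bar>f x\<bar> \<le> B)"

text \<open>The functional that is maximised in the Donsker--Varadhan formula.\<close>
definition gibbs_functional :: "'a measure \<Rightarrow> 'a measure \<Rightarrow> ('a \<Rightarrow> real) \<Rightarrow> real" where
  "gibbs_functional \<mu> \<nu> f = (LINT x|\<mu>. f x) - ln (LINT x|\<nu>. exp (f x))"

lemma bounded_measurable_integrable:
  assumes "prob_space \<mu>" "sets \<mu> = sets S" "bounded_measurable S f"
  shows "integrable \<mu> f" "integrable \<mu> (\<lambda>x. exp (f x))"
proof -
  interpret prob_space \<mu> by fact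
  obtain B where B: "\<And>x. \<bar>f x\<bar> \<le> B" and [measurable]: "f \<in> borel_measurable S"
    using assms(3) by (auto simp: bounded_measurable_def)
  note assms(2)[measurable_cong]
  show "integrable \<mu> f"
    using B by (intro integrable_const_bound[where B=B]) auto
  have "f x \<le> B" for x using B[of x] by linarith
  then show "integrable \<mu> (\<lambda>x. exp (f x))"
    by (intro integrable_const_bound[where B="exp B"]) auto
qed

lemma integral_exp_pos:
  assumes "prob_space \<nu>" "integrable \<nu> (\<lambda>x. exp (f x :: real))"
  shows "0 < (LINT x|\<nu>. exp (f x))"
proof -
  interpret prob_space \<nu> by fact
  show ?thesis
    using integral_less_AE_space[of "\<lambda>_. 0" "\<lambda>x. exp (f x)"] assms(2) emeasure_space_1 by auto
qed

section \<open>The variational formula for a density\<close>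

text \<open>The value of relative entropy when \<open>\<rho>\<close> is a density of \<open>\<mu>\<close>.\<close>
abbreviation ln_integral :: "'a measure \<Rightarrow> ('a \<Rightarrow> real) \<Rightarrow> ereal" where
  "ln_integral \<mu> \<rho> \<equiv> enn2ereal (\<integral>\<^sup>+x. ennreal (ln (\<rho> x)) \<partial>\<mu>) -
                      enn2ereal (\<integral>\<^sup>+x. ennreal (- ln (\<rho> x)) \<partial>\<mu>)"

lemma relative_entropy_density:
  assumes "prob_space \<nu>" "prob_space \<mu>" "sets \<mu> = sets \<nu>" "absolutely_continuous \<nu> \<mu>"
  obtains \<rho> where "\<rho> \<in> borel_measurable \<nu>" "\<And>x. 0 \<le> \<rho> x" "\<mu> = density \<nu> (\<lambda>x. ennreal (\<rho> x))"
    "relative_entropy \<mu> \<nu> = ln_integral \<mu> \<rho>"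
proof
  interpret \<nu>: prob_space \<nu> by fact
  interpret \<mu>: prob_space \<mu> by fact
  let ?\<rho> = "\<lambda>x. enn2real (RN_deriv \<nu> \<mu> x)"
  show "?\<rho> \<in> borel_measurable \<nu>" "\<And>x. 0 \<le> ?\<rho> x"
    by auto
  have "AE x in \<nu>. RN_deriv \<nu> \<mu> x \<noteq> \<infinity>"
    using \<nu>.RN_deriv_finite[OF _ assms(4,3)] \<mu>.sigma_finite_measure_axioms by blast
  then have "AE x in \<nu>. RN_deriv \<nu> \<mu> x = ennreal (?\<rho> x)"
    by eventually_elim (auto simp: less_top)
  then have "density \<nu> (RN_deriv \<nu> \<mu>) = density \<nu> (\<lambda>x. ennreal (?\<rho> x))"
    by (intro density_cong) auto
  then show "\<mu> = density \<nu> (\<lambda>x. ennreal (?\<rho> x))"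
    using \<nu>.density_RN_deriv[OF assms(4,3)] by simp
  show "relative_entropy \<mu> \<nu> = ln_integral \<mu> ?\<rho>"
    using assms(4) by (simp add: relative_entropy_def entropy_density_def log_ln[symmetric])
qed

text \<open>
  The near-optimal test functions: the maximiser \<open>ln \<rho>\<close>, cut off at \<open>\<plusminus>k\<close>. Where \<open>\<rho>\<close> vanishes, the
  logarithm should be \<open>-\<infinity>\<close>, while \<open>ln 0 = 0\<close> by convention; the value \<open>-k\<close> there keeps the
  exponential small on a set that may carry \<open>\<nu>\<close>-mass.
\<close>
definition truncated_ln :: "('a \<Rightarrow> real) \<Rightarrow> nat \<Rightarrow> 'a \<Rightarrow> real" where
  "truncated_ln \<rho> k x =
     (if \<rho> x = 0 then - real k else max (- real k) (min (real k) (ln (\<rho> x))))"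

context
  fixes \<mu> \<nu> :: "'a measure" and \<rho> :: "'a \<Rightarrow> real"
  assumes \<mu>: "prob_space \<mu>" and \<nu>: "prob_space \<nu>"
    and \<rho>[measurable]: "\<rho> \<in> borel_measurable \<nu>" and \<rho>_nonneg: "\<And>x. 0 \<le> \<rho> x"
    and dens: "\<mu> = density \<nu> (\<lambda>x. ennreal (\<rho> x))"
begin

lemma AE_density_pos: "AE x in \<mu>. 0 < \<rho> x"
  unfolding dens by (subst AE_density) (auto simp: \<rho>_nonneg)

text \<open>
  Dividing by the density undoes the change of measure from \<open>\<nu>\<close> to \<open>\<mu>\<close>, except that the part of
  \<open>\<nu>\<close> on the zero set of \<open>\<rho>\<close> is lost; hence an inequality. Combined with \<open>ln t \<le> t - 1\<close>, it gives
  both the finiteness of the negative part of the entropy and the Gibbs inequality.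
\<close>
lemma nn_integral_divide_density_le:
  assumes [measurable]: "u \<in> borel_measurable \<nu>" and "\<And>x. 0 \<le> u x"
  shows "(\<integral>\<^sup>+x. ennreal (u x / \<rho> x) \<partial>\<mu>) \<le> (\<integral>\<^sup>+x. ennreal (u x) \<partial>\<nu>)"
proof -
  have "(\<integral>\<^sup>+x. ennreal (u x / \<rho> x) \<partial>\<mu>) = (\<integral>\<^sup>+x. ennreal (\<rho> x) * ennreal (u x / \<rho> x) \<partial>\<nu>)"
    unfolding dens by (rule nn_integral_density) auto
  also have "\<dots> \<le> (\<integral>\<^sup>+x. ennreal (u x) \<partial>\<nu>)"
    using assms(2) \<rho>_nonneg by (intro nn_integral_mono) (simp add: ennreal_mult[symmetric])
  finally show ?thesis .
qed

lemma nn_integral_neg_ln_density_le: "(\<integral>\<^sup>+x. ennreal (- ln (\<rho> x)) \<partial>\<mu>) \<le> 1"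
proof -
  interpret \<nu>: prob_space \<nu> by fact
  have "(\<integral>\<^sup>+x. ennreal (- ln (\<rho> x)) \<partial>\<mu>) \<le> (\<integral>\<^sup>+x. ennreal (1 / \<rho> x) \<partial>\<mu>)"
  proof (rule nn_integral_mono_AE)
    show "AE x in \<mu>. ennreal (- ln (\<rho> x)) \<le> ennreal (1 / \<rho> x)"
      using AE_density_pos
    proof eventually_elim
      case (elim x)
      then show ?case
        using ln_le_minus_one[of "1 / \<rho> x"] by (intro ennreal_leI) (simp add: ln_div)
    qed
  qed
  also have "\<dots> \<le> (\<integral>\<^sup>+x. ennreal 1 \<partial>\<nu>)"
    by (rule nn_integral_divide_density_le) auto
  finally show ?thesis
    by (simp add: \<nu>.emeasure_space_1)
qed

text \<open>
  The Gibbs inequality. Normalise \<open>e\<^sup>f\<close> to a \<open>\<nu>\<close>-probability density \<open>e\<^sup>f/Z\<close> and let \<open>h\<close> be its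
  quotient by \<open>\<rho>\<close>. Then \<open>f - ln Z - ln \<rho> = ln h \<le> h - 1\<close> holds \<open>\<mu>\<close>-almost everywhere, and
  \<open>\<integral>h d\<mu> \<le> 1\<close>.
\<close>
lemma gibbs_functional_le_ln_integral:
  assumes "bounded_measurable \<nu> f"
  shows "ereal (gibbs_functional \<mu> \<nu> f) \<le> ln_integral \<mu> \<rho>"
proof (cases "(\<integral>\<^sup>+x. ennreal (ln (\<rho> x)) \<partial>\<mu>) = \<infinity>")
  case True
  have "enn2ereal (\<integral>\<^sup>+x. ennreal (- ln (\<rho> x)) \<partial>\<mu>) \<noteq> \<infinity>"
    using nn_integral_neg_ln_density_le by (auto simp: top_unique)
  with True show ?thesis
    by (cases "enn2ereal (\<integral>\<^sup>+x. ennreal (- ln (\<rho> x)) \<partial>\<mu>)") auto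
next
  case False
  interpret \<mu>: prob_space \<mu> by fact
  interpret \<nu>: prob_space \<nu> by fact
  have sets[measurable_cong]: "sets \<mu> = sets \<nu>"
    by (simp add: dens)
  have [measurable]: "f \<in> borel_measurable \<nu>"
    using assms by (simp add: bounded_measurable_def)
  have L: "integrable \<mu> (\<lambda>x. ln (\<rho> x))"
    unfolding real_integrable_def using False nn_integral_neg_ln_density_le
    by (auto simp: top_unique)
  have f: "integrable \<mu> f" "integrable \<nu> (\<lambda>x. exp (f x))"
    using bounded_measurable_integrable[OF \<mu> sets assms]
      bounded_measurable_integrable[OF \<nu> refl assms] by auto
  define Z where "Z = (LINT x|\<nu>. exp (f x))"
  have Z: "Z > 0"
    unfolding Z_def by (rule integral_exp_pos[OF \<nu> f(2)])
  define h where "h x = exp (f x) / Z / \<rho> x" for x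
  have [measurable]: "h \<in> borel_measurable \<nu>"
    unfolding h_def by measurable
  have "(\<integral>\<^sup>+x. ennreal (h x) \<partial>\<mu>) \<le> (\<integral>\<^sup>+x. ennreal (exp (f x) / Z) \<partial>\<nu>)"
    unfolding h_def using Z by (intro nn_integral_divide_density_le) auto
  also have "\<dots> = ennreal (LINT x|\<nu>. exp (f x) / Z)"
    using f(2) Z by (intro nn_integral_eq_integral) auto
  also have "\<dots> = 1"
    using Z by (simp add: Z_def[symmetric])
  finally have h_nn: "(\<integral>\<^sup>+x. ennreal (h x) \<partial>\<mu>) \<le> 1" .
  have h0: "0 \<le> h x" for x
    using Z \<rho>_nonneg by (simp add: h_def)
  have h: "integrable \<mu> h"
    by (rule integrableI_nonneg) (use h_nn h0 in \<open>auto simp: le_less_trans\<close>)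
  have h1: "(LINT x|\<mu>. h x) \<le> 1"
    using h_nn nn_integral_eq_integral[OF h] h0 by simp
  have "(LINT x|\<mu>. f x - ln Z) \<le> (LINT x|\<mu>. ln (\<rho> x) + h x - 1)"
  proof (rule integral_mono_AE)
    show "AE x in \<mu>. f x - ln Z \<le> ln (\<rho> x) + h x - 1"
      using AE_density_pos
    proof eventually_elim
      case (elim x)
      have "f x - ln Z - ln (\<rho> x) = ln (h x)"
        using elim Z by (simp add: h_def ln_div ln_mult)
      also have "\<dots> \<le> h x - 1"
        using elim Z by (intro ln_le_minus_one) (simp add: h_def)
      finally show ?case by simp
    qed
  qed (use f L h in auto)
  then have "gibbs_functional \<mu> \<nu> f \<le> (LINT x|\<mu>. ln (\<rho> x))"
    using f L h h1 by (simp add: gibbs_functional_def Z_def \<mu>.prob_space)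
  also have "ereal \<dots> = ln_integral \<mu> \<rho>"
    using L by (elim integrableE) auto
  finally show ?thesis
    by (simp del: ereal_minus)
qed

lemma bounded_measurable_truncated_ln: "bounded_measurable \<nu> (truncated_ln \<rho> k)"
  unfolding bounded_measurable_def truncated_ln_def[abs_def]
  by (intro conjI exI[of _ "real k"]) auto

text \<open>
  Truncation raises \<open>ln \<rho>\<close> at most to \<open>-k\<close>, so \<open>exp (truncated_ln \<rho> k) \<le> \<rho> + e\<^sup>-\<^sup>k\<close>, and \<open>\<rho>\<close> has
  \<open>\<nu>\<close>-integral 1.
\<close>
lemma ln_integral_exp_truncated_ln_le:
  "ln (LINT x|\<nu>. exp (truncated_ln \<rho> k x)) \<le> exp (- real k)"
proof -
  interpret \<mu>: prob_space \<mu> by fact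
  interpret \<nu>: prob_space \<nu> by fact
  have nn: "(\<integral>\<^sup>+x. ennreal (\<rho> x) \<partial>\<nu>) = 1"
    using \<mu>.emeasure_space_1 unfolding dens by (simp add: emeasure_density cong: nn_integral_cong)
  have int: "integrable \<nu> \<rho>"
    by (rule integrableI_nonneg) (use nn \<rho>_nonneg in auto)
  have one: "(LINT x|\<nu>. \<rho> x) = 1"
    using nn nn_integral_eq_integral[OF int] \<rho>_nonneg by simp
  have e: "integrable \<nu> (\<lambda>x. exp (truncated_ln \<rho> k x))"
    using bounded_measurable_integrable[OF \<nu> refl bounded_measurable_truncated_ln] by blast
  have "exp (truncated_ln \<rho> k x) \<le> \<rho> x + exp (- real k)" for x
  proof (cases "\<rho> x = 0")
    case False
    then have pos: "\<rho> x > 0" using \<rho>_nonneg[of x] by linarith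
    then have "exp (truncated_ln \<rho> k x) \<le> exp (- real k) \<or>
        exp (truncated_ln \<rho> k x) \<le> exp (ln (\<rho> x))"
      unfolding exp_le_cancel_iff by (auto simp: truncated_ln_def)
    moreover have "exp (ln (\<rho> x)) = \<rho> x"
      using pos by simp
    ultimately show ?thesis
      using pos exp_ge_zero[of "- real k"] by linarith
  qed (simp add: truncated_ln_def)
  then have "(LINT x|\<nu>. exp (truncated_ln \<rho> k x)) \<le> (LINT x|\<nu>. \<rho> x + exp (- real k))"
    using e int by (intro integral_mono) auto
  also have "\<dots> = 1 + exp (- real k)"
    using int one by (simp add: \<nu>.prob_space)
  finally show ?thesis
    using ln_le_minus_one[OF integral_exp_pos[OF \<nu> e]] by linarith
qed

text \<open>
  Monotone convergence applies to the positive and the negative parts separately, and the limit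
  of the negative parts is finite, so the difference of the limits is well defined even if the
  entropy is infinite.
\<close>
lemma integral_truncated_ln_tendsto:
  "(\<lambda>k. ereal (LINT x|\<mu>. truncated_ln \<rho> k x)) \<longlonglongrightarrow> ln_integral \<mu> \<rho>"
proof -
  interpret \<mu>: prob_space \<mu> by fact
  have sets[measurable_cong]: "sets \<mu> = sets \<nu>"
    by (simp add: dens)
  have lim: "(\<lambda>k. \<integral>\<^sup>+x. ennreal (min (real k) (u x)) \<partial>\<mu>) \<longlonglongrightarrow> (\<integral>\<^sup>+x. ennreal (u x) \<partial>\<mu>)"
    if [measurable]: "u \<in> borel_measurable \<mu>" for u :: "'a \<Rightarrow> real"
  proof (rule nn_integral_LIMSEQ)
    show "incseq (\<lambda>k x. ennreal (min (real k) (u x)))"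
      by (auto simp: incseq_def le_fun_def intro!: ennreal_leI)
    fix x
    obtain m where "u x \<le> real m" using real_arch_simple by blast
    then have "eventually (\<lambda>k. ennreal (min (real k) (u x)) = ennreal (u x)) sequentially"
      by (intro eventually_sequentiallyI[of m]) (auto simp: min_def)
    then show "(\<lambda>k. ennreal (min (real k) (u x))) \<longlonglongrightarrow> ennreal (u x)"
      by (rule tendsto_eventually)
  qed auto
  have eq: "ereal (LINT x|\<mu>. truncated_ln \<rho> k x) =
      enn2ereal (\<integral>\<^sup>+x. ennreal (min (real k) (ln (\<rho> x))) \<partial>\<mu>) -
      enn2ereal (\<integral>\<^sup>+x. ennreal (min (real k) (- ln (\<rho> x))) \<partial>\<mu>)" for k
  proof -
    \<comment> \<open>The cut-off at \<open>-k\<close> is invisible to \<open>ennreal\<close>, which sends negative numbers to 0.\<close>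
    have cut: "ennreal (max (- real k) y) = ennreal y" for y
      by (cases "y < - real k") (auto simp: ennreal_neg max_def)
    have neg: "- max (- real k) (min (real k) y) = max (- real k) (min (real k) (- y))" for y
      by (auto simp: max_def min_def)
    have "integrable \<mu> (truncated_ln \<rho> k)"
      using bounded_measurable_integrable[OF \<mu> sets bounded_measurable_truncated_ln] by blast
    then have "ereal (LINT x|\<mu>. truncated_ln \<rho> k x) =
        enn2ereal (\<integral>\<^sup>+x. ennreal (truncated_ln \<rho> k x) \<partial>\<mu>) -
        enn2ereal (\<integral>\<^sup>+x. ennreal (- truncated_ln \<rho> k x) \<partial>\<mu>)"
      by (elim integrableE) auto
    also have "(\<integral>\<^sup>+x. ennreal (truncated_ln \<rho> k x) \<partial>\<mu>) =
        (\<integral>\<^sup>+x. ennreal (min (real k) (ln (\<rho> x))) \<partial>\<mu>)"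
      by (rule nn_integral_cong_AE, use AE_density_pos in eventually_elim)
        (simp add: truncated_ln_def cut)
    also have "(\<integral>\<^sup>+x. ennreal (- truncated_ln \<rho> k x) \<partial>\<mu>) =
        (\<integral>\<^sup>+x. ennreal (min (real k) (- ln (\<rho> x))) \<partial>\<mu>)"
      by (rule nn_integral_cong_AE, use AE_density_pos in eventually_elim)
        (simp add: truncated_ln_def neg cut)
    finally show ?thesis .
  qed
  have "enn2ereal (\<integral>\<^sup>+x. ennreal (- ln (\<rho> x)) \<partial>\<mu>) \<noteq> \<infinity>"
    using nn_integral_neg_ln_density_le by (auto simp: top_unique)
  then show ?thesis
    unfolding eq by (intro tendsto_diff_ereal_general tendsto_enn2erealI lim) auto
qed

end

section \<open>The Donsker--Varadhan formula\<close>

lemma gibbs_functional_le_relative_entropy: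
  assumes "prob_space \<mu>" "prob_space \<nu>" "sets \<mu> = sets \<nu>" "bounded_measurable \<nu> f"
  shows "ereal (gibbs_functional \<mu> \<nu> f) \<le> relative_entropy \<mu> \<nu>"
proof (cases "absolutely_continuous \<nu> \<mu>")
  case True
  then obtain \<rho> where \<rho>: "\<rho> \<in> borel_measurable \<nu>" "\<And>x. 0 \<le> \<rho> x" "\<mu> = density \<nu> (\<lambda>x. ennreal (\<rho> x))"
    and H: "relative_entropy \<mu> \<nu> = ln_integral \<mu> \<rho>"
    using relative_entropy_density assms(1-3) by metis
  show ?thesis
    unfolding H by (rule gibbs_functional_le_ln_integral[OF assms(1,2) \<rho> assms(4)])
qed (simp add: relative_entropy_def)

lemma relative_entropy_nonneg:
  assumes "prob_space \<mu>" "prob_space \<nu>" "sets \<mu> = sets \<nu>"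
  shows "0 \<le> relative_entropy \<mu> \<nu>"
proof -
  interpret \<nu>: prob_space \<nu> by fact
  have "bounded_measurable \<nu> (\<lambda>_. 0)"
    by (auto simp: bounded_measurable_def)
  from gibbs_functional_le_relative_entropy[OF assms this] show ?thesis
    by (simp add: gibbs_functional_def \<nu>.prob_space zero_ereal_def)
qed

text \<open>
  With a density, the truncations of its logarithm work, by a sandwich between their integrals
  minus \<open>e\<^sup>-\<^sup>k\<close> and the Gibbs inequality. Without one, there is a \<open>\<nu>\<close>-null set \<open>A\<close> of positive
  \<open>\<mu>\<close>-measure, and the multiples of its indicator drive the functional to infinity, since \<open>\<nu>\<close>
  does not see them.
\<close>
lemma gibbs_functional_tendsto_relative_entropy:
  assumes "prob_space \<mu>" "prob_space \<nu>" "sets \<mu> = sets \<nu>"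
  obtains f where "\<And>k. bounded_measurable \<nu> (f k)"
    "(\<lambda>k::nat. ereal (gibbs_functional \<mu> \<nu> (f k))) \<longlonglongrightarrow> relative_entropy \<mu> \<nu>"
proof (cases "absolutely_continuous \<nu> \<mu>")
  case True
  then obtain \<rho> where \<rho>: "\<rho> \<in> borel_measurable \<nu>" "\<And>x. 0 \<le> \<rho> x" "\<mu> = density \<nu> (\<lambda>x. ennreal (\<rho> x))"
    and H: "relative_entropy \<mu> \<nu> = ln_integral \<mu> \<rho>"
    using relative_entropy_density assms(1-3) by metis
  note D = assms(1,2) \<rho>
  let ?f = "truncated_ln \<rho>"
  have bm: "bounded_measurable \<nu> (?f k)" for k
    by (rule bounded_measurable_truncated_ln[OF D])
  have "(\<lambda>k. exp (- real k)) \<longlonglongrightarrow> 0"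
    by (rule filterlim_compose[OF exp_at_bot])
      (simp add: filterlim_uminus_at_bot filterlim_real_sequentially)
  then have "(\<lambda>k. ereal (LINT x|\<mu>. ?f k x) - ereal (exp (- real k)))
      \<longlonglongrightarrow> relative_entropy \<mu> \<nu> - ereal 0"
    unfolding H by (intro tendsto_diff_ereal_general integral_truncated_ln_tendsto[OF D]) auto
  moreover have "relative_entropy \<mu> \<nu> - ereal 0 = relative_entropy \<mu> \<nu>"
    by (cases "relative_entropy \<mu> \<nu>") auto
  ultimately have "(\<lambda>k. ereal (LINT x|\<mu>. ?f k x) - ereal (exp (- real k)))
      \<longlonglongrightarrow> relative_entropy \<mu> \<nu>"
    by (simp only:)
  then have "(\<lambda>k. ereal (gibbs_functional \<mu> \<nu> (?f k))) \<longlonglongrightarrow> relative_entropy \<mu> \<nu>"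
  proof (rule tendsto_sandwich[rotated 2, OF _ tendsto_const])
    show "\<forall>\<^sub>F k in sequentially. ereal (LINT x|\<mu>. ?f k x) - ereal (exp (- real k))
        \<le> ereal (gibbs_functional \<mu> \<nu> (?f k))"
      using ln_integral_exp_truncated_ln_le[OF D] by (auto simp: gibbs_functional_def)
    show "\<forall>\<^sub>F k in sequentially. ereal (gibbs_functional \<mu> \<nu> (?f k)) \<le> relative_entropy \<mu> \<nu>"
      by (intro always_eventually allI gibbs_functional_le_relative_entropy assms bm)
  qed
  with bm show ?thesis by (rule that)
next
  case False
  interpret \<mu>: prob_space \<mu> by fact
  interpret \<nu>: prob_space \<nu> by fact
  obtain A where A: "A \<in> null_sets \<nu>" "A \<notin> null_sets \<mu>"
    using False by (auto simp: absolutely_continuous_def)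
  have [measurable]: "A \<in> sets \<nu>" using A by auto
  have pos: "measure \<mu> A > 0"
    using A assms(3) by (auto simp: null_sets_def \<mu>.emeasure_eq_measure zero_less_measure_iff)
  let ?f = "\<lambda>k x. real k * indicator A x :: real"
  have bm: "bounded_measurable \<nu> (?f k)" for k
    unfolding bounded_measurable_def
    by (intro conjI exI[of _ "real k"]) (auto simp: indicator_def)
  have one: "(LINT x|\<nu>. exp (?f k x)) = 1" for k
  proof -
    have "AE x in \<nu>. x \<notin> A"
      using A(1) by (rule AE_not_in)
    then have "AE x in \<nu>. exp (?f k x) = 1"
      by eventually_elim auto
    then have "(LINT x|\<nu>. exp (?f k x)) = (LINT x|\<nu>. 1)"
      by (intro integral_cong_AE) auto
    then show ?thesis by (simp add: \<nu>.prob_space)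
  qed
  have g: "gibbs_functional \<mu> \<nu> (?f k) = real k * measure \<mu> A" for k
    unfolding gibbs_functional_def one using assms(3) A(1)
    by (simp add: Int_absorb2 sets.sets_into_space)
  have "filterlim (\<lambda>k. real k * measure \<mu> A) at_top sequentially"
    by (rule filterlim_at_top_mult_tendsto_pos[OF tendsto_const pos filterlim_real_sequentially])
  then have "(\<lambda>k. ereal (gibbs_functional \<mu> \<nu> (?f k))) \<longlonglongrightarrow> relative_entropy \<mu> \<nu>"
    unfolding g using False by (simp add: relative_entropy_def tendsto_PInfty_eq_at_top)
  with bm show ?thesis by (rule that)
qed

section \<open>Superadditivity of relative entropy\<close>

lemma tendsto_sum_ereal_nonneg_limits:
  fixes f :: "'i \<Rightarrow> 'b \<Rightarrow> ereal"
  assumes "finite I" "\<And>i. i \<in> I \<Longrightarrow> (f i \<longlongrightarrow> a i) F" "\<And>i. i \<in> I \<Longrightarrow> 0 \<le> a i"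
  shows "((\<lambda>x. \<Sum>i\<in>I. f i x) \<longlongrightarrow> (\<Sum>i\<in>I. a i)) F"
  using assms
proof (induction I rule: finite_induct)
  case (insert i I)
  have "0 \<le> a i" "0 \<le> sum a I" using insert by (auto intro: sum_nonneg)
  then have "a i \<noteq> -\<infinity>" "sum a I \<noteq> -\<infinity>" by auto
  then show ?case
    using insert by (simp add: tendsto_add_ereal_nonneg)
qed simp

text \<open>
  Test functions \<open>f\<^sub>i\<close> for the marginals combine to the test function \<open>\<Sum>i. f\<^sub>i \<circ> g\<^sub>i\<close> for the joint
  laws: the integral is additive by linearity, and the logarithm of the exponential integral is
  additive by independence.
\<close>
lemma relative_entropy_superadditive:
  assumes P: "prob_space P" and P': "prob_space P'" and I: "finite I"
    and X: "X \<in> measurable P S" and Y: "Y \<in> measurable P' S"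
    and g: "\<And>i. i \<in> I \<Longrightarrow> g i \<in> measurable S (T i)"
    and indep: "prob_space.indep_vars P' T (\<lambda>i w. g i (Y w)) I"
  shows "(\<Sum>i\<in>I. relative_entropy (distr P (T i) (\<lambda>w. g i (X w)))
                                  (distr P' (T i) (\<lambda>w. g i (Y w))))
    \<le> relative_entropy (distr P S X) (distr P' S Y)"
proof -
  interpret P: prob_space P by fact
  interpret P': prob_space P' by fact
  let ?\<mu> = "\<lambda>i. distr P (T i) (\<lambda>w. g i (X w))" and ?\<nu> = "\<lambda>i. distr P' (T i) (\<lambda>w. g i (Y w))"
  note [measurable] = X Y
  have gX: "(\<lambda>w. g i (X w)) \<in> measurable P (T i)"
    and gY: "(\<lambda>w. g i (Y w)) \<in> measurable P' (T i)" if "i \<in> I" for i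
    using g[OF that] by measurable
  have ps: "prob_space (?\<mu> i)" "prob_space (?\<nu> i)" if "i \<in> I" for i
    using P.prob_space_distr[OF gX[OF that]] P'.prob_space_distr[OF gY[OF that]] by auto
  have "\<exists>f. (\<forall>k. bounded_measurable (?\<nu> i) (f k)) \<and>
      (\<lambda>k::nat. ereal (gibbs_functional (?\<mu> i) (?\<nu> i) (f k))) \<longlonglongrightarrow> relative_entropy (?\<mu> i) (?\<nu> i)"
    if "i \<in> I" for i
    by (rule gibbs_functional_tendsto_relative_entropy[OF ps[OF that]]) auto
  then obtain f where bm: "\<And>i k. i \<in> I \<Longrightarrow> bounded_measurable (?\<nu> i) (f i k)"
    and lim: "\<And>i. i \<in> I \<Longrightarrow> (\<lambda>k::nat. ereal (gibbs_functional (?\<mu> i) (?\<nu> i) (f i k)))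
      \<longlonglongrightarrow> relative_entropy (?\<mu> i) (?\<nu> i)"
    by metis
  have "(\<Sum>i\<in>I. ereal (gibbs_functional (?\<mu> i) (?\<nu> i) (f i k)))
      \<le> relative_entropy (distr P S X) (distr P' S Y)" for k
  proof -
    have f_meas: "f i k \<in> borel_measurable (T i)" if "i \<in> I" for i
      using bm[OF that, of k] by (simp add: bounded_measurable_def)
    have "\<exists>B. \<forall>x. \<bar>f i k x\<bar> \<le> B" if "i \<in> I" for i
      using bm[OF that, of k] by (simp add: bounded_measurable_def)
    then obtain B where B: "\<And>i x. i \<in> I \<Longrightarrow> \<bar>f i k x\<bar> \<le> B i"
      by metis
    let ?F = "\<lambda>s. \<Sum>i\<in>I. f i k (g i s)"
    have F_meas[measurable]: "?F \<in> borel_measurable S"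
      using f_meas g by (intro borel_measurable_sum) (auto intro: measurable_compose)
    have "\<bar>?F s\<bar> \<le> (\<Sum>i\<in>I. B i)" for s
      using B by (intro order_trans[OF sum_abs] sum_mono) auto
    then have F: "bounded_measurable (distr P' S Y) ?F"
      unfolding bounded_measurable_def using F_meas by auto
    have int: "integrable (?\<mu> i) (f i k)" "integrable (?\<nu> i) (\<lambda>t. exp (f i k t))" if "i \<in> I" for i
      using bounded_measurable_integrable[OF ps(1)[OF that] _ bm[OF that]]
        bounded_measurable_integrable[OF ps(2)[OF that] _ bm[OF that]] by auto
    have "(LINT s|distr P S X. ?F s) = (LINT w|P. (\<Sum>i\<in>I. f i k (g i (X w))))"
      by (subst integral_distr) auto
    also have "\<dots> = (\<Sum>i\<in>I. LINT w|P. f i k (g i (X w)))"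
      using int(1) f_meas gX
      by (intro Bochner_Integration.integral_sum) (auto simp: integrable_distr_eq)
    also have "\<dots> = (\<Sum>i\<in>I. LINT t|?\<mu> i. f i k t)"
      using f_meas gX by (intro sum.cong) (auto simp: integral_distr)
    finally have lin: "(LINT s|distr P S X. ?F s) = (\<Sum>i\<in>I. LINT t|?\<mu> i. f i k t)" .
    have "(LINT s|distr P' S Y. exp (?F s)) = (LINT w|P'. exp (?F (Y w)))"
      by (rule integral_distr) measurable
    also have "\<dots> = (LINT w|P'. (\<Prod>i\<in>I. exp (f i k (g i (Y w)))))"
      by (simp add: exp_sum[OF I])
    also have "\<dots> = (\<Prod>i\<in>I. LINT w|P'. exp (f i k (g i (Y w))))"
    proof (rule P'.indep_vars_lebesgue_integral[OF I])
      show "P'.indep_vars (\<lambda>_. borel) (\<lambda>i w. exp (f i k (g i (Y w)))) I"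
        using f_meas by (intro P'.indep_vars_compose2[OF indep]) auto
    qed (use int(2) f_meas gY in \<open>auto simp: integrable_distr_eq\<close>)
    also have "\<dots> = (\<Prod>i\<in>I. LINT t|?\<nu> i. exp (f i k t))"
      using f_meas gY by (intro prod.cong) (auto simp: integral_distr)
    finally have "ln (LINT s|distr P' S Y. exp (?F s)) = ln (\<Prod>i\<in>I. LINT t|?\<nu> i. exp (f i k t))"
      by simp
    also have "\<dots> = (\<Sum>i\<in>I. ln (LINT t|?\<nu> i. exp (f i k t)))"
      using integral_exp_pos[OF ps(2) int(2)] by (intro ln_prod I) fastforce
    finally have "(\<Sum>i\<in>I. gibbs_functional (?\<mu> i) (?\<nu> i) (f i k)) =
        gibbs_functional (distr P S X) (distr P' S Y) ?F"
      unfolding gibbs_functional_def lin by (simp add: sum_subtractf)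
    also have "ereal \<dots> \<le> relative_entropy (distr P S X) (distr P' S Y)"
      using F by (intro gibbs_functional_le_relative_entropy P.prob_space_distr P'.prob_space_distr)
        auto
    finally show ?thesis
      by simp
  qed
  moreover have "(\<lambda>k. \<Sum>i\<in>I. ereal (gibbs_functional (?\<mu> i) (?\<nu> i) (f i k)))
      \<longlonglongrightarrow> (\<Sum>i\<in>I. relative_entropy (?\<mu> i) (?\<nu> i))"
    using lim ps by (intro tendsto_sum_ereal_nonneg_limits I relative_entropy_nonneg) auto
  ultimately show ?thesis
    by (intro LIMSEQ_le_const2) auto
qed

section \<open>Coordinates of vector-valued paths\<close>

definition path_coord :: "'l \<Rightarrow> (real \<Rightarrow> real ^ 'l) \<Rightarrow> real \<Rightarrow> real" where
  "path_coord i \<omega> = (\<lambda>t\<in>{0..1}. \<omega> t $ i)"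

lemma path_of_coord: "path_of (\<lambda>t w. X t w $ i) w = path_coord i (path_of X w)"
  by (auto simp: path_of_def path_coord_def)

lemma measurable_path_coord: "path_coord i \<in> measurable path_space path_space"
  unfolding path_space_def
proof (rule measurable_restrict_space2)
  have "continuous_on {0..1} (path_coord i \<omega>)" if "continuous_on {0..1} \<omega>" for \<omega>
  proof (rule continuous_on_eq)
    show "continuous_on {0..1} (\<lambda>t. \<omega> t $ i)"
      using that by (rule continuous_on_component)
  qed (simp add: path_coord_def)
  then show "path_coord i \<in> space (restrict_space (PiM {0..1} (\<lambda>_. borel))
      {\<omega>. continuous_on {0..1} \<omega>}) \<rightarrow> {\<omega>. continuous_on {0..1} \<omega>}"
    by (auto simp: space_restrict_space)
  have "(\<lambda>\<omega>. \<omega> t $ i) \<in> borel_measurable (PiM {0..1} (\<lambda>_. borel :: (real ^ 'a) measure))"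
    if "t \<in> {0..1}" for t
    by (rule measurable_compose[OF measurable_component_singleton[OF that]])
      (intro borel_measurable_continuous_onI continuous_intros)
  then show "path_coord i \<in> measurable
      (restrict_space (PiM {0..1} (\<lambda>_. borel)) {\<omega>. continuous_on {0..1} \<omega>}) (PiM {0..1} (\<lambda>_. borel))"
    unfolding path_coord_def[abs_def]
    by (intro measurable_restrict measurable_restrict_space1) auto
qed

text \<open>
  The value of a coordinate at a grid point is a function of the value of the path at the same
  grid point, so the coordinate maps respect the grid algebras.
\<close>
lemma measurable_path_coord_grid_algebra:
  assumes "n > 0"
  shows "path_coord i \<in> measurable (grid_algebra n) (grid_algebra n)"
proof -
  have sp: "path_coord i \<omega> \<in> space path_space" if "\<omega> \<in> space path_space" for \<omega>
    using measurable_space[OF measurable_path_coord that] .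
  show ?thesis
    unfolding grid_algebra_def[where 'a=real]
  proof (rule measurable_measure_of)
    fix G assume "G \<in> {(\<lambda>\<omega>. \<omega> (real k / real n)) -` A \<inter> space path_space
      | k A. k \<le> n \<and> A \<in> sets (borel::real measure)}"
    then obtain k A where k: "k \<le> n" and A: "A \<in> sets borel"
      and G: "G = (\<lambda>\<omega>. \<omega> (real k / real n)) -` A \<inter> space path_space" by auto
    have t: "real k / real n \<in> {0..1}" using k assms by auto
    have "(\<lambda>v::real^'a. v $ i) -` A \<in> sets borel"
      using measurable_sets[OF _ A, of "\<lambda>v::real^'a. v $ i" borel] by simp
    moreover have "path_coord i -` G \<inter> space (grid_algebra n) =
       (\<lambda>\<omega>. \<omega> (real k / real n)) -` ((\<lambda>v. v $ i) -` A) \<inter> space path_space"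
      using sp t by (auto simp: G path_coord_def grid_algebra_def space_measure_of_conv)
    ultimately show "path_coord i -` G \<inter> space (grid_algebra n) \<in> sets (grid_algebra n)"
      using k unfolding grid_algebra_def by (auto intro!: in_measure_of)
  qed (use sp in \<open>auto simp: grid_algebra_def space_measure_of_conv\<close>)
qed

section \<open>Passage to the specific relative entropy\<close>

lemma measurable_into_subalgebra:
  assumes "subalgebra N F" "X \<in> measurable P N"
  shows "X \<in> measurable P F"
  using assms by (auto simp: subalgebra_def measurable_def)

lemma restr_to_subalg_distr:
  assumes "subalgebra N F" "X \<in> measurable P N"
  shows "restr_to_subalg (distr P N X) F = distr P F X"
proof (rule measure_eqI)
  have sub: "subalgebra (distr P N X) F"
    using assms(1) by (simp add: subalgebra_def)
  show "sets (restr_to_subalg (distr P N X) F) = sets (distr P F X)"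
    by (simp add: sets_restr_to_subalg[OF sub])
  fix A assume "A \<in> sets (restr_to_subalg (distr P N X) F)"
  then have A: "A \<in> sets F" by (simp add: sets_restr_to_subalg[OF sub])
  then have "A \<in> sets N" using assms(1) by (auto simp: subalgebra_def)
  then show "emeasure (restr_to_subalg (distr P N X) F) A = emeasure (distr P F X) A"
    using A assms measurable_into_subalgebra[OF assms]
    by (simp add: emeasure_restr_to_subalg[OF sub] emeasure_distr)
qed

lemma sum_liminf_le_liminf_sum:
  fixes a :: "'i \<Rightarrow> nat \<Rightarrow> ereal"
  assumes "finite I" "\<And>i n. i \<in> I \<Longrightarrow> 0 \<le> a i n"
  shows "(\<Sum>i\<in>I. liminf (a i)) \<le> liminf (\<lambda>n. \<Sum>i\<in>I. a i n)"
  using assms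
proof (induction I rule: finite_induct)
  case (insert i I)
  have "(\<Sum>j\<in>insert i I. liminf (a j)) \<le> liminf (a i) + liminf (\<lambda>n. \<Sum>j\<in>I. a j n)"
    using insert by (auto intro: add_left_mono)
  also have "\<dots> \<le> liminf (\<lambda>n. a i n + (\<Sum>j\<in>I. a j n))"
    using insert by (intro Liminf_add_le) (auto intro!: always_eventually sum_nonneg)
  finally show ?case using insert by simp
qed (simp add: Liminf_const)

theorem lemma4p2:
  fixes P :: "'w measure" and P' :: "'v measure"
    and F :: "real \<Rightarrow> 'w measure" and F' :: "real \<Rightarrow> 'v measure"
    and M :: "real \<Rightarrow> 'w \<Rightarrow> real ^ 'l" and N :: "real \<Rightarrow> 'v \<Rightarrow> real ^ 'l"
  assumes "continuous_martingale P F M"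
    and "continuous_martingale P' F' N"
    and "prob_space.indep_vars P' (\<lambda>_. path_space) (\<lambda>i. path_of (\<lambda>t w. N t w $ i)) UNIV"
  shows "specific_relative_entropy (path_law P M) (path_law P' N)
    \<ge> (\<Sum>i\<in>UNIV. specific_relative_entropy (path_law P (\<lambda>t w. M t w $ i))
                                           (path_law P' (\<lambda>t w. N t w $ i)))"
proof -
  interpret P: prob_space P using assms(1) by (simp add: continuous_martingale_def)
  interpret P': prob_space P' using assms(2) by (simp add: continuous_martingale_def)
  note M = measurable_path_of[OF assms(1)] and N = measurable_path_of[OF assms(2)]
  let ?G = "\<lambda>n. grid_algebra (2 ^ n) :: (real \<Rightarrow> real ^ 'l) measure"
  let ?g = "\<lambda>n. grid_algebra (2 ^ n) :: (real \<Rightarrow> real) measure"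
  have subG: "subalgebra path_space (?G n)" and subg: "subalgebra path_space (?g n)" for n
    by (simp_all add: subalgebra_grid_algebra)
  have Mi: "path_of (\<lambda>t w. M t w $ i) \<in> measurable P path_space"
    and Ni: "path_of (\<lambda>t w. N t w $ i) \<in> measurable P' path_space" for i
    unfolding path_of_coord[abs_def]
    using measurable_compose[OF M measurable_path_coord]
      measurable_compose[OF N measurable_path_coord] by auto
  let ?H = "\<lambda>n. relative_entropy (distr P (?G n) (path_of M)) (distr P' (?G n) (path_of N))"
  let ?h = "\<lambda>i n. relative_entropy (distr P (?g n) (path_of (\<lambda>t w. M t w $ i)))
                                   (distr P' (?g n) (path_of (\<lambda>t w. N t w $ i)))"
  have nonneg: "0 \<le> ?h i n" for i n
    using measurable_into_subalgebra[OF subg Mi] measurable_into_subalgebra[OF subg Ni]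
    by (intro relative_entropy_nonneg P.prob_space_distr P'.prob_space_distr) auto
  have step: "(\<Sum>i\<in>UNIV. ?h i n) \<le> ?H n" for n
    unfolding path_of_coord[abs_def]
  proof (rule relative_entropy_superadditive)
    have "P'.indep_vars (\<lambda>_. ?g n) (\<lambda>i w. path_of (\<lambda>t w. N t w $ i) w) UNIV"
      by (rule P'.indep_vars_compose2[OF assms(3), where Y="\<lambda>_ x. x"])
        (rule measurable_into_subalgebra[OF subg], simp)
    then show "P'.indep_vars (\<lambda>_. ?g n) (\<lambda>i w. path_coord i (path_of N w)) UNIV"
      by (simp only: path_of_coord)
    show "path_coord i \<in> measurable (?G n) (?g n)" for i :: 'l
      by (rule measurable_path_coord_grid_algebra) simp
  qed (use measurable_into_subalgebra[OF subG M] measurable_into_subalgebra[OF subG N]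
        P.prob_space_axioms P'.prob_space_axioms in auto)
  have "(\<Sum>i\<in>UNIV. liminf (\<lambda>n. ereal (1 / 2 ^ n) * ?h i n))
      \<le> liminf (\<lambda>n. \<Sum>i\<in>UNIV. ereal (1 / 2 ^ n) * ?h i n)"
    using nonneg by (intro sum_liminf_le_liminf_sum) auto
  also have "\<dots> = liminf (\<lambda>n. ereal (1 / 2 ^ n) * (\<Sum>i\<in>UNIV. ?h i n))"
    by (simp only: sum_ereal_right_distrib[OF nonneg])
  also have "\<dots> \<le> liminf (\<lambda>n. ereal (1 / 2 ^ n) * ?H n)"
    using step by (intro Liminf_mono always_eventually allI ereal_mult_left_mono) auto
  finally show ?thesis
    unfolding specific_relative_entropy_def path_law_def
    by (simp only: restr_to_subalg_distr[OF subG M] restr_to_subalg_distr[OF subG N]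
        restr_to_subalg_distr[OF subg Mi] restr_to_subalg_distr[OF subg Ni])
qed

end
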